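(* There is no function $\psi:T\to\mathbb{C}$ such that $M_\psi$ is an isometry from $L^\infty$ to $\mathcal{L}_{\mathbf{w}}$, and there is no function $\psi:T\to\mathbb{C}$ such that $M_\psi$ is an isometry from $L^\infty$ to $\mathcal{L}_{\mathbf{w},0}$.
   Context: $T$ is the vertex set of a tree (a locally finite, connected, simply connected graph), rooted at a vertex $o$ and without terminal vertices (a terminal vertex is one having a unique neighbor), hence infinite. $|v|$ is the number of edges in the path from $o$ to $v$; $T^*=T\setminus\{o\}$; for $v\in T^*$, $v^-$ is the neighbor of $v$ closest to $o$. For $f:T\to\mathbb{C}$ and $v\in T^*$, $Df(v)=|f(v)-f(v^-)|$. The weighted Lipschitz space $\mathcal{L}_{\mathbf{w}}$ is the Banach space of all $f:T\to\mathbb{C}$ with $\sup_{v\in T^*}|v|Df(v)<\infty$, with norm $\|f\|_{\mathbf{w}}=|f(o)|+\sup_{v\in T^*}|v|Df(v)$; the little weighted Lipschitz space is the closed subspace $\mathcal{L}_{\mathbf{w},0}=\{f\in\mathcal{L}_{\mathbf{w}}:\lim_{|v|\to\infty}|v|Df(v)=0\}$. $L^\infty$ is the Banach space of bounded functions $f:T\to\mathbb{C}$ with $\|f\|_\infty=\sup_{v\in T}|f(v)|$. For $\psi:T\to\mathbb{C}$, $M_\psi f=\psi f$ (pointwise product). $M_\psi$ is an isometry from $X$ to $Y$ if $\psi f\in Y$ and $\|\psi f\|_Y=\|f\|_X$ for all $f\in X$. *)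

theory Defs
  imports Complex_Main "Graph_Theory.Graph_Theory"
begin

text \<open>
  A simple graph is a loop-free symmetric digraph whose arcs are ordered pairs, so an edge
  \<open>{u, v}\<close> appears as the two arcs \<open>(u, v)\<close> and \<open>(v, u)\<close>. The library predicate \<open>tree\<close> forbids
  directed cycles, hence also the closed walk \<open>u, v, u\<close> along a single edge, and is of no use for
  symmetric digraphs; cycles of an undirected graph are those with at least three arcs.
\<close>

locale rooted_tree = pair_bidirected_digraph G
  for G :: "'v pair_pre_digraph" +
  fixes root :: 'v
  assumes tree_connected: "Digraph_Component.connected (with_proj G)"
    and tree_acyclic: "\<not> (\<exists>p. cycle p \<and> 3 \<le> length p)"
    and locally_finite: "\<And>v. v \<in> pverts G \<Longrightarrow> finite {u. (v, u) \<in> parcs G}"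
    and root_in_verts: "root \<in> pverts G"
begin

definition neighbours :: "'v \<Rightarrow> 'v set"
  where "neighbours v = {u. (v, u) \<in> parcs G}"

definition terminal :: "'v \<Rightarrow> bool"
  where "terminal v \<longleftrightarrow> v \<in> pverts G \<and> (\<exists>!u. u \<in> neighbours v)"

definition nonroot :: "'v set"
  where "nonroot = pverts G - {root}"

definition depth :: "'v \<Rightarrow> nat"
  where "depth v = length (THE p. apath root p v)"

definition parent :: "'v \<Rightarrow> 'v"
  where "parent v = arg_min depth (\<lambda>u. u \<in> neighbours v)"

text \<open>
  Functions on the tree are functions on the ambient type \<open>'v\<close>; everything below depends only on
  their values on the vertex set.
\<close>

definition D :: "('v \<Rightarrow> complex) \<Rightarrow> 'v \<Rightarrow> real"
  where "D f v = cmod (f v - f (parent v))"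

definition Lip_w :: "('v \<Rightarrow> complex) set"
  where "Lip_w = {f. bdd_above ((\<lambda>v. real (depth v) * D f v) ` nonroot)}"

definition norm_w :: "('v \<Rightarrow> complex) \<Rightarrow> real"
  where "norm_w f = cmod (f root) + (SUP v\<in>nonroot. real (depth v) * D f v)"

definition Lip_w0 :: "('v \<Rightarrow> complex) set"
  where "Lip_w0 = {f \<in> Lip_w.
    ((\<lambda>v. real (depth v) * D f v) \<longlongrightarrow> 0) (inf (filtercomap depth at_top) (principal nonroot))}"

definition L_inf :: "('v \<Rightarrow> complex) set"
  where "L_inf = {f. bdd_above ((\<lambda>v. cmod (f v)) ` pverts G)}"

definition norm_inf :: "('v \<Rightarrow> complex) \<Rightarrow> real"
  where "norm_inf f = (SUP v\<in>pverts G. cmod (f v))"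

end

text \<open>
  The one-vertex tree has no vertex with a unique neighbour either; it is excluded because the trees
  considered here are infinite. Given the other assumptions, being infinite is equivalent to having
  a vertex other than the root.
\<close>

locale terminal_free_tree = rooted_tree +
  assumes no_terminal: "\<not> (\<exists>v. terminal v)"
    and nontrivial: "pverts G \<noteq> {root}"

definition mult_op :: "('v \<Rightarrow> complex) \<Rightarrow> ('v \<Rightarrow> complex) \<Rightarrow> 'v \<Rightarrow> complex"
  where "mult_op \<psi> f = (\<lambda>v. \<psi> v * f v)"

definition isometry_between ::
    "'f set \<Rightarrow> ('f \<Rightarrow> real) \<Rightarrow> 'g set \<Rightarrow> ('g \<Rightarrow> real) \<Rightarrow> ('f \<Rightarrow> 'g) \<Rightarrow> bool"
  where "isometry_between X norm_X Y norm_Y A \<longleftrightarrow> (\<forall>f\<in>X. A f \<in> Y \<and> norm_Y (A f) = norm_X f)"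

end

theory Submission
  imports Defs
begin

text \<open>
  Write \<open>o\<close> for the root. Since multiplying by \<open>\<psi>\<close> preserves the norm of the indicator of \<open>o\<close>, whose
  image has norm at most \<open>2 |\<psi>(o)|\<close>, we get \<open>|\<psi>(o)| \<ge> 1/2\<close>. For a child \<open>v\<close> of \<open>o\<close> the indicator
  of \<open>v\<close> has image of norm at most \<open>2 |\<psi>(v)|\<close>, so \<open>|\<psi>(v)| \<ge> 1/2\<close>. Now let \<open>f\<close> be \<open>1\<close> at \<open>o\<close>,
  a unimodular \<open>\<lambda>\<close> at \<open>v\<close> and zero elsewhere, where \<open>\<lambda>\<close> turns \<open>\<psi>(v) \<lambda>\<close> in the direction opposite
  to \<open>\<psi>(o)\<close>. Then \<open>\<parallel>f\<parallel> = 1\<close>, but \<open>\<psi> f\<close> has norm at least \<open>2 |\<psi>(o)| + |\<psi>(v)| \<ge> 3/2\<close>.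
\<close>

text \<open>With \<open>c\<close> minus the direction of \<open>a\<close> times the conjugate
  direction of \<open>b\<close>, the product \<open>b * c\<close> points opposite to
  \<open>a\<close>, so the moduli add. If \<open>a\<close> or \<open>b\<close> vanishes,
  \<open>c = 1\<close> works.\<close>

lemma exists_unimodular_opposite:
  fixes a b :: complex
  shows "\<exists>c. cmod c = 1 \<and> cmod (b * c - a) = cmod a + cmod b"
proof (cases "a = 0 \<or> b = 0")
  case True
  then show ?thesis
    by (intro exI[of _ 1]) auto
next
  case False
  define c where "c = - sgn a * cnj (sgn b)"
  have a: "a = complex_of_real (cmod a) * sgn a" for a :: complex
    by (cases "a = 0") (auto simp: sgn_eq)
  have "b * cnj (sgn b) = complex_of_real (cmod b)"
    using False by (simp add: sgn_eq complex_norm_square[symmetric] power2_eq_square)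
  then have "b * c - a = - (sgn a * complex_of_real (cmod b) + complex_of_real (cmod a) * sgn a)"
    using a[of a] by (simp add: c_def mult.left_commute mult.commute)
  also have "\<dots> = - (complex_of_real (cmod a + cmod b) * sgn a)"
    by (simp add: algebra_simps)
  finally have "cmod (b * c - a) = cmod a + cmod b"
    using False by (simp add: norm_mult norm_sgn del: of_real_add)
  moreover have "cmod c = 1"
    using False by (simp add: c_def norm_mult norm_sgn)
  ultimately show ?thesis
    by blast
qed

context rooted_tree
begin

text \<open>Any other path from \<open>u\<close> to \<open>v\<close> has at least two arcs, so
  closing it with the reverse arc \<open>(v, u)\<close> would give a cycle that
  \<open>tree_acyclic\<close> forbids.\<close>

lemma apath_along_arc:
  assumes "(u, v) \<in> parcs G" and p: "apath u p v"
  shows "p = [(u, v)]"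
proof (rule ccontr)
  assume ne: "p \<noteq> [(u, v)]"
  have uv: "u \<noteq> v" and vu: "(v, u) \<in> parcs G"
    using assms no_loops' arcs_symmetric by auto
  have awalk: "awalk u p v" and dist: "distinct (pawalk_verts u p)"
    using p by (auto simp: apath_def)
  obtain e q where eq: "p = e # q"
    using p uv by (cases p) (auto simp: apath_Nil_iff)
  have "q \<noteq> []"
    using p ne eq by (cases e) (auto simp: apath_simps)
  then have len: "3 \<le> length (p @ [(v, u)])"
    using eq by (cases q) auto
  have closed: "awalk u (p @ [(v, u)]) u"
    using awalk vu by (intro awalk_appendI[of u p v]) (auto simp: awalk_simps in_arcsD2)
  \<comment> \<open>The closed walk lists \<open>u\<close> at both ends; dropping the first
    occurrence leaves a rotation of the distinct vertices of \<open>p\<close>.\<close>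
  have "pawalk_verts u (p @ [(v, u)]) = pawalk_verts u p @ [u]"
    using awalk_verts_append[OF closed] awalk by (auto elim: awalkE)
  moreover have "pawalk_verts u p = u # tl (pawalk_verts u p)"
    using eq p by (auto simp: apath_simps)
  ultimately have "distinct (tl (pawalk_verts u (p @ [(v, u)])))"
    using dist by (metis distinct1_rotate distinct.simps(2) list.sel(3) append_Cons rotate1.simps(2))
  then have "cycle (p @ [(v, u)])"
    using closed by (auto simp: cycle_def)
  with len tree_acyclic show False
    by blast
qed

text \<open>A path through \<open>v\<close> splits there into two halves, each a single arc by
  \<open>apath_along_arc\<close>. A path avoiding \<open>v\<close> could be extended by
  \<open>(w, v)\<close>, and that same lemma would then force \<open>w = u\<close>.\<close>

lemma apath_along_two_arcs:
  assumes uv: "(u, v) \<in> parcs G" and vw: "(v, w) \<in> parcs G" and "u \<noteq> w" and p: "apath u p w"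
  shows "p = [(u, v), (v, w)]"
proof (cases "v \<in> set (pawalk_verts u p)")
  case True
  then obtain q r where qr: "p = q @ r" "awalk u q v" "awalk v r w"
    using p awalk_decomp[of u p w v] by (auto simp: apath_def)
  then have "apath u q v" "apath v r w"
    using p apath_append_iff[of u q r w] by (auto elim: awalkE)
  then show ?thesis
    using apath_along_arc uv vw qr by auto
next
  case False
  have wv: "(w, v) \<in> parcs G" "v \<noteq> w"
    using vw arcs_symmetric no_loops' by auto
  have awalk: "awalk u p w"
    using p by (simp add: apath_def)
  then have last: "last (pawalk_verts u p) = w"
    by (auto elim: awalkE)
  have "apath u (p @ [(w, v)]) v"
    using p False wv last in_arcsD2[of w v] by (auto simp: apath_append_iff apath_simps)
  with apath_along_arc[OF uv] have "p @ [(w, v)] = [(u, v)]"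
    by blast
  then show ?thesis
    using \<open>u \<noteq> w\<close> by simp
qed

lemma depth_root: "depth root = 0"
proof -
  have "p = []" if "apath root p root" for p
    using that apath_nonempty_ends by blast
  moreover have "apath root [] root"
    using root_in_verts by (simp add: apath_Nil_iff)
  ultimately have "(THE p. apath root p root) = []"
    by blast
  then show ?thesis
    by (simp add: depth_def)
qed

lemma depth_child_of_root:
  assumes "(root, v) \<in> parcs G"
  shows "depth v = 1"
proof -
  have "apath root [(root, v)] v"
    using assms no_loops' in_arcsD2 by (auto simp: apath_simps)
  then have "(THE p. apath root p v) = [(root, v)]"
    using apath_along_arc[OF assms] by blast
  then show ?thesis
    by (simp add: depth_def)
qed

lemma depth_grandchild_of_root:
  assumes "(root, v) \<in> parcs G" "(v, w) \<in> parcs G" "w \<noteq> root"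
  shows "depth w = 2"
proof -
  have "apath root [(root, v), (v, w)] w"
    using assms no_loops' in_arcsD2 by (auto simp: apath_simps)
  then have "(THE p. apath root p w) = [(root, v), (v, w)]"
    using apath_along_two_arcs[OF assms(1,2)] assms(3) by blast
  then show ?thesis
    by (simp add: depth_def)
qed

text \<open>\<open>connected\<close> speaks of the symmetric closure; as the arcs are already
  symmetric, it yields directed reachability.\<close>

lemma reachable_in_tree:
  assumes "u \<in> pverts G" "v \<in> pverts G"
  shows "u \<rightarrow>\<^sup>*\<^bsub>with_proj G\<^esub> v"
  using symmetric_connected_imp_strongly_connected[OF pair_sym_arcs tree_connected] assms
  by (simp add: strongly_connected_def)

lemma exists_neighbour:
  assumes "u \<in> pverts G" "v \<in> pverts G" "u \<noteq> v"
  obtains w where "(u, w) \<in> parcs G"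
  using reachable_in_tree[OF assms(1,2)] assms(3) that
  by (auto elim: converse_reachable_cases)

text \<open>\<open>arg_min\<close> returns a neighbour only if there is one; connectedness to the
  root provides it.\<close>

lemma parent_arc:
  assumes "v \<in> nonroot"
  shows "(v, parent v) \<in> parcs G"
proof -
  obtain w where "(v, w) \<in> parcs G"
    using assms root_in_verts exists_neighbour[of v root] by (auto simp: nonroot_def)
  then have "parent v \<in> neighbours v"
    unfolding parent_def by (intro arg_min_natI) (simp add: neighbours_def)
  then show ?thesis
    by (simp add: neighbours_def)
qed

text \<open>Any neighbour of \<open>v\<close> other than the root has depth 2, whereas the root is a
  neighbour of depth 0, so the minimum is attained only there.\<close>

lemma parent_child_of_root:
  assumes "(root, v) \<in> parcs G"
  shows "parent v = root"
proof (rule ccontr)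
  assume ne: "parent v \<noteq> root"
  have "v \<in> nonroot"
    using assms no_loops' in_arcsD2 by (auto simp: nonroot_def)
  then have "depth (parent v) = 2"
    using assms ne parent_arc depth_grandchild_of_root by blast
  moreover have "depth (parent v) \<le> depth root"
    unfolding parent_def
    using assms arcs_symmetric by (intro arg_min_nat_le) (simp add: neighbours_def)
  ultimately show False
    by (simp add: depth_root)
qed

lemma norm_inf_eq_one:
  assumes "\<And>v. v \<in> pverts G \<Longrightarrow> cmod (f v) \<le> 1" "u \<in> pverts G" "cmod (f u) = 1"
  shows "f \<in> L_inf" "norm_inf f = 1"
proof -
  show bdd: "f \<in> L_inf"
    using assms(1) by (auto simp: L_inf_def intro!: bdd_aboveI)
  have "norm_inf f \<le> 1"
    unfolding norm_inf_def using assms(1,2) by (intro cSUP_least) auto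
  moreover have "cmod (f u) \<le> norm_inf f"
    unfolding norm_inf_def using bdd assms(2) by (intro cSUP_upper) (auto simp: L_inf_def)
  ultimately show "norm_inf f = 1"
    using assms(3) by simp
qed

text \<open>Leaving \<open>Y\<close> open treats \<open>Lip_w\<close> and \<open>Lip_w0\<close> at
  once, since both carry \<open>norm_w\<close>.\<close>

lemma no_mult_isometry:
  assumes "pverts G \<noteq> {root}" "Y \<subseteq> Lip_w"
  shows "\<not> isometry_between L_inf norm_inf Y norm_w (mult_op \<psi>)"
proof
  assume iso: "isometry_between L_inf norm_inf Y norm_w (mult_op \<psi>)"
  have nrm: "norm_w (mult_op \<psi> f) = 1 \<and> mult_op \<psi> f \<in> Lip_w"
    if "\<And>v. v \<in> pverts G \<Longrightarrow> cmod (f v) \<le> 1" "u \<in> pverts G" "cmod (f u) = 1" for f u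
    using iso norm_inf_eq_one[of f u] that assms(2) by (auto simp: isometry_between_def)
  obtain x where "x \<in> pverts G" "x \<noteq> root"
    using assms(1) root_in_verts by blast
  then obtain v where v: "(root, v) \<in> parcs G"
    using exists_neighbour[OF root_in_verts] by metis
  have v_in: "v \<in> pverts G" "v \<in> nonroot" "v \<noteq> root"
    using v no_loops' in_arcsD2 by (auto simp: nonroot_def)
  note dv = depth_child_of_root[OF v] and pv = parent_child_of_root[OF v]

  define g where "g = mult_op \<psi> (\<lambda>x. if x = root then 1 else 0)"
  \<comment> \<open>Away from the root, \<open>g\<close> varies only at children of the root, where
    the weight is 1.\<close>
  have "real (depth x) * D g x \<le> cmod (\<psi> root)" if "x \<in> nonroot" for x
  proof (cases "parent x = root")
    case True
    then have "depth x = 1"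
      using parent_arc[OF that] arcs_symmetric depth_child_of_root by metis
    then show ?thesis
      using that True by (simp add: D_def g_def mult_op_def nonroot_def)
  next
    case False
    then show ?thesis
      using that by (simp add: D_def g_def mult_op_def nonroot_def)
  qed
  then have "(SUP x\<in>nonroot. real (depth x) * D g x) \<le> cmod (\<psi> root)"
    using v_in by (intro cSUP_least) auto
  moreover have "norm_w g = 1"
    unfolding g_def using nrm[of _ root] root_in_verts by auto
  ultimately have psi_root: "1 / 2 \<le> cmod (\<psi> root)"
    by (simp add: norm_w_def g_def mult_op_def)

  define h where "h = mult_op \<psi> (\<lambda>x. if x = v then 1 else 0)"
  \<comment> \<open>\<open>h\<close> varies at \<open>v\<close>, with weight 1, and at the children
    of \<open>v\<close>, with weight 2; the latter give the factor 2.\<close>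
  have "real (depth x) * D h x \<le> 2 * cmod (\<psi> v)" if "x \<in> nonroot" for x
  proof (cases "x = v")
    case True
    then show ?thesis
      using dv pv v_in by (simp add: D_def h_def mult_op_def)
  next
    case False
    show ?thesis
    proof (cases "parent x = v")
      case True
      then have "depth x = 2"
        using parent_arc[OF that] arcs_symmetric depth_grandchild_of_root[OF v] that
        by (auto simp: nonroot_def)
      then show ?thesis
        using False True by (simp add: D_def h_def mult_op_def)
    qed (use False in \<open>simp add: D_def h_def mult_op_def\<close>)
  qed
  then have "(SUP x\<in>nonroot. real (depth x) * D h x) \<le> 2 * cmod (\<psi> v)"
    using v_in by (intro cSUP_least) auto
  moreover have "norm_w h = 1"
    unfolding h_def using nrm[of _ v] v_in by auto
  ultimately have psi_v: "1 / 2 \<le> cmod (\<psi> v)"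
    using v_in by (simp add: norm_w_def h_def mult_op_def)

  obtain c where c: "cmod c = 1" "cmod (\<psi> v * c - \<psi> root) = cmod (\<psi> root) + cmod (\<psi> v)"
    using exists_unimodular_opposite by blast
  define k where "k = mult_op \<psi> (\<lambda>x. if x = root then 1 else if x = v then c else 0)"
  have k: "norm_w k = 1" "k \<in> Lip_w"
    unfolding k_def using nrm[of _ root] root_in_verts c(1) by auto
  \<comment> \<open>Membership in \<open>Lip_w\<close> bounds the family, without which the real
    supremum need not dominate its terms.\<close>
  have "real (depth v) * D k v \<le> (SUP x\<in>nonroot. real (depth x) * D k x)"
    using k(2) v_in by (intro cSUP_upper) (auto simp: Lip_w_def)
  then have "cmod (\<psi> root) + (cmod (\<psi> root) + cmod (\<psi> v)) \<le> norm_w k"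
    using v_in dv pv c(2) by (simp add: norm_w_def D_def k_def mult_op_def)
  then show False
    using psi_root psi_v k(1) by simp
qed

end

theorem theorem5p3:
  fixes G :: "'v pair_pre_digraph" and root :: 'v
  assumes "terminal_free_tree G root"
  shows "\<not> (\<exists>\<psi> :: 'v \<Rightarrow> complex.
            isometry_between (rooted_tree.L_inf G) (rooted_tree.norm_inf G)
              (rooted_tree.Lip_w G root) (rooted_tree.norm_w G root) (mult_op \<psi>))
       \<and> \<not> (\<exists>\<psi> :: 'v \<Rightarrow> complex.
            isometry_between (rooted_tree.L_inf G) (rooted_tree.norm_inf G)
              (rooted_tree.Lip_w0 G root) (rooted_tree.norm_w G root) (mult_op \<psi>))"
proof -
  interpret terminal_free_tree G root
    by fact
  have "Lip_w0 \<subseteq> Lip_w"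
    by (auto simp: Lip_w0_def)
  then show ?thesis
    using no_mult_isometry[OF nontrivial] by blast
qed

end
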